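(* The class $W_1$ of almost contact metric manifolds and its subclass $W_1^0$ decompose into the following subclasses: $$W_1=W_{11}\oplus W_{12}\oplus W_{13}\oplus W_{17}\oplus W_{18}\oplus W_{19},$$ $$W_1^0=W_{11}\oplus W_{12}\oplus W_{13}\oplus W_{17}\oplus W_{19}.$$ That is, $W_1$ coincides with the class of manifolds in $W_1$ whose Lee form satisfies $\theta\in\Omega_1\oplus\Omega_2\oplus\Omega_3\oplus\Omega_7\oplus\Omega_8\oplus\Omega_9$, and $W_1^0$ coincides with the class of manifolds in $W_1$ whose Lee form satisfies $\theta\in\Omega_1\oplus\Omega_2\oplus\Omega_3\oplus\Omega_7\oplus\Omega_9$.
   Context: An almost contact metric manifold $M^{2n+1}(\varphi,\xi,\eta,g)$ is a $(2n+1)$-dimensional manifold with a $(1,1)$-tensor field $\varphi$, a vector field $\xi$, a 1-form $\eta$ and a Riemannian metric $g$ such that $\varphi^2=-\mathrm{id}+\eta\otimes\xi$, $\varphi(\xi)=0$, $\eta\circ\varphi=0$, $g(\xi,\xi)=1$, $g(\varphi x,\varphi y)=g(x,y)-\eta(x)\eta(y)$. $\nabla$ is the Levi-Civita connection, $h=-\varphi^2$, $\Phi(x,y)=g(x,\varphi y)$, $F=-\nabla\Phi$, i.e. $F(x,y,z)=-(\nabla_x\Phi)(y,z)$, and $\omega(z)=F(\xi,\xi,z)$. The class $W_1$ consists of the almost contact metric manifolds with $F=\eta\otimes(\eta\wedge\omega)$, i.e. $F(x,y,z)=\eta(x)[\eta(y)\omega(z)-\eta(z)\omega(y)]$. The Lee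 form of a manifold in $W_1$ is $\theta=\omega\circ\varphi$. $W_1^0$ is the subclass of $W_1$ of manifolds with $d\theta=0$. For a $(0,2)$-tensor $L$ put $SL(x,y)=\frac12[L(x,y)+L(y,x)]$, $AL(x,y)=\frac12[L(x,y)-L(y,x)]$, $hL(x,y)=L(hx,hy)$, $vL(x,y)=\eta(x)L(\xi,y)+\eta(y)L(x,\xi)-2\eta(x)\eta(y)L(\xi,\xi)$, $wL(x,y)=\eta(x)\eta(y)L(\xi,\xi)$, $(L\circ\varphi)(x,y)=L(\varphi x,\varphi y)$, and, for a local basis $\{e_i\}$ with dual basis $\{e^i\}$, $\alpha=g(e^i,e^j)hL(e_i,e_j)$, $\beta=g(e^i,e^j)hL(e_i,\varphi e_j)$ (summation over $i,j$). Define $L_1(L)(x,y)=\frac{\alpha}{2n}hg(x,y)$; $L_2(L)=\frac12[ShL+ShL\circ\varphi]-L_1(L)$; $L_3(L)=\frac12[ShL-ShL\circ\varphi]$; $L_4(L)(x,y)=-\frac{\beta}{2n}hg(x,\varphi y)$; $L_5(L)=\frac12[AhL+AhL\circ\varphi]-L_4(L)$; $L_6(L)=\frac12[AhL-AhL\circ\varphi]$; $L_7(L)=SvL$; $L_8(L)=AvL$; $L_9(L)=wL$. For a 1-form $\theta$ let $L(\theta)=\nabla\theta$, i.e. $L(\theta)(x,y)=(\nabla_x\theta)(y)$, and $L_i(\theta)=L_i(L(\theta))$. $\Omega_i$ is the space of 1-forms with $L(\theta)=L_i(\theta)$, and $\bigoplus_{i\in I}\Omega_i$ denotes the space of 1-forms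 with $L(\theta)=\sum_{i\in I}L_i(\theta)$. A manifold in $W_1$ is in the subclass $W_{1j}$ if its Lee form lies in $\Omega_j$, and $\bigoplus_{j\in I}W_{1j}$ is the class of manifolds in $W_1$ whose Lee form lies in $\bigoplus_{j\in I}\Omega_j$. *)

theory Defs
  imports "HOL-Analysis.Analysis" "HOL-Library.Function_Algebras"
begin

section \<open>Smooth manifolds\<close>

text \<open>\<^term>\<open>Ck_on k S f\<close>: \<open>f\<close> is of class \<open>C\<^sup>k\<close> on the open set \<open>S\<close>.\<close>

primrec Ck_on :: "nat \<Rightarrow> 'e set \<Rightarrow> ('e::euclidean_space \<Rightarrow> 'b::real_normed_vector) \<Rightarrow> bool" where
  "Ck_on 0 S f \<longleftrightarrow> continuous_on S f"
| "Ck_on (Suc k) S f \<longleftrightarrow>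
     f differentiable_on S \<and> (\<forall>v. Ck_on k S (\<lambda>x. frechet_derivative f (at x) v))"

definition smooth_on :: "'e set \<Rightarrow> ('e::euclidean_space \<Rightarrow> 'b::real_normed_vector) \<Rightarrow> bool" where
  "smooth_on S f \<longleftrightarrow> (\<forall>k. Ck_on k S f)"

record ('a, 'e) manifold =
  mtop :: "'a topology"
  atlas :: "('a set \<times> ('a \<Rightarrow> 'e)) set"

abbreviation pts :: "('a, 'e, 'm) manifold_scheme \<Rightarrow> 'a set" where
  "pts M \<equiv> topspace (mtop M)"

text \<open>The dimension of the manifold is the dimension of the model space \<open>'e\<close>.
  The atlas need not be maximal.\<close>

definition smooth_manifold :: "('a, 'e::euclidean_space, 'm) manifold_scheme \<Rightarrow> bool" where
  "smooth_manifold M \<longleftrightarrow>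
     Hausdorff_space (mtop M) \<and> second_countable (mtop M) \<and>
     (\<Union>(U, c)\<in>atlas M. U) = pts M \<and>
     (\<forall>(U, c)\<in>atlas M. openin (mtop M) U \<and> open (c ` U) \<and>
        homeomorphic_map (subtopology (mtop M) U) (top_of_set (c ` U)) c) \<and>
     (\<forall>(U, c)\<in>atlas M. \<forall>(V, d)\<in>atlas M. smooth_on (c ` (U \<inter> V)) (d \<circ> inv_into U c))"

text \<open>Real functions on \<open>M\<close> are extended by \<open>0\<close> outside the underlying set, tangent vectors by \<open>0\<close>
  outside the smooth functions and vector fields by \<open>0\<close> outside the underlying set, so that equality
  of these objects is equality of HOL functions.  Sums and products of functions are pointwise.\<close>

definition smooth_funs :: "('a, 'e::euclidean_space, 'm) manifold_scheme \<Rightarrow> ('a \<Rightarrow> real) set" where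
  "smooth_funs M = {f. (\<forall>p. p \<notin> pts M \<longrightarrow> f p = 0) \<and>
     (\<forall>(U, c)\<in>atlas M. smooth_on (c ` U) (f \<circ> inv_into U c))}"

type_synonym 'a tvector = "('a \<Rightarrow> real) \<Rightarrow> real"
type_synonym 'a vfield = "'a \<Rightarrow> 'a tvector"
type_synonym 'a tensor01 = "'a vfield \<Rightarrow> 'a \<Rightarrow> real"
type_synonym 'a tensor02 = "'a vfield \<Rightarrow> 'a vfield \<Rightarrow> 'a \<Rightarrow> real"
type_synonym 'a tensor11 = "'a vfield \<Rightarrow> 'a vfield"

definition tangent_space ::
    "('a, 'e::euclidean_space, 'm) manifold_scheme \<Rightarrow> 'a \<Rightarrow> 'a tvector set" where
  "tangent_space M p = {v.
     (\<forall>f\<in>smooth_funs M. \<forall>h\<in>smooth_funs M. v (f + h) = v f + v h) \<and>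
     (\<forall>a. \<forall>f\<in>smooth_funs M. v (\<lambda>q. a * f q) = a * v f) \<and>
     (\<forall>f\<in>smooth_funs M. \<forall>h\<in>smooth_funs M. v (f * h) = f p * v h + h p * v f) \<and>
     (\<forall>f. f \<notin> smooth_funs M \<longrightarrow> v f = 0)}"

definition deriv_along :: "'a vfield \<Rightarrow> ('a \<Rightarrow> real) \<Rightarrow> 'a \<Rightarrow> real" where
  "deriv_along x f = (\<lambda>p. x p f)"

definition vfields :: "('a, 'e::euclidean_space, 'm) manifold_scheme \<Rightarrow> 'a vfield set" where
  "vfields M = {x. (\<forall>p\<in>pts M. x p \<in> tangent_space M p) \<and> (\<forall>p. p \<notin> pts M \<longrightarrow> x p = 0) \<and>
     (\<forall>f\<in>smooth_funs M. deriv_along x f \<in> smooth_funs M)}"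

definition vscale :: "('a \<Rightarrow> real) \<Rightarrow> 'a vfield \<Rightarrow> 'a vfield"  (infixr "\<cdot>\<^sub>v" 75) where
  "f \<cdot>\<^sub>v x = (\<lambda>p h. f p * x p h)"

definition lie_bracket :: "'a vfield \<Rightarrow> 'a vfield \<Rightarrow> 'a vfield" where
  "lie_bracket x y = (\<lambda>p f. x p (deriv_along y f) - y p (deriv_along x f))"

text \<open>Tensor fields are multilinear maps over the ring of smooth functions, acting on vector fields.\<close>

definition one_forms :: "('a, 'e::euclidean_space, 'm) manifold_scheme \<Rightarrow> 'a tensor01 set" where
  "one_forms M = {\<theta>.
     (\<forall>x\<in>vfields M. \<theta> x \<in> smooth_funs M) \<and>
     (\<forall>x\<in>vfields M. \<forall>y\<in>vfields M. \<theta> (x + y) = \<theta> x + \<theta> y) \<and>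
     (\<forall>f\<in>smooth_funs M. \<forall>x\<in>vfields M. \<theta> (f \<cdot>\<^sub>v x) = f * \<theta> x)}"

definition tensors02 :: "('a, 'e::euclidean_space, 'm) manifold_scheme \<Rightarrow> 'a tensor02 set" where
  "tensors02 M = {B. \<forall>x\<in>vfields M. B x \<in> one_forms M \<and> (\<lambda>y. B y x) \<in> one_forms M}"

definition tensors11 :: "('a, 'e::euclidean_space, 'm) manifold_scheme \<Rightarrow> 'a tensor11 set" where
  "tensors11 M = {T.
     (\<forall>x\<in>vfields M. T x \<in> vfields M) \<and>
     (\<forall>x\<in>vfields M. \<forall>y\<in>vfields M. T (x + y) = T x + T y) \<and>
     (\<forall>f\<in>smooth_funs M. \<forall>x\<in>vfields M. T (f \<cdot>\<^sub>v x) = f \<cdot>\<^sub>v T x)}"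

definition riemannian_metric ::
    "('a, 'e::euclidean_space, 'm) manifold_scheme \<Rightarrow> 'a tensor02 \<Rightarrow> bool" where
  "riemannian_metric M g \<longleftrightarrow> g \<in> tensors02 M \<and>
     (\<forall>x\<in>vfields M. \<forall>y\<in>vfields M. g x y = g y x) \<and>
     (\<forall>x\<in>vfields M. \<forall>p\<in>pts M. x p \<noteq> 0 \<longrightarrow> g x x p > 0)"

definition levi_civita :: "('a, 'e::euclidean_space, 'm) manifold_scheme \<Rightarrow> 'a tensor02 \<Rightarrow>
    ('a vfield \<Rightarrow> 'a vfield \<Rightarrow> 'a vfield) \<Rightarrow> bool" where
  "levi_civita M g D \<longleftrightarrow>
     (\<forall>x\<in>vfields M. \<forall>y\<in>vfields M. D x y \<in> vfields M) \<and>
     (\<forall>x\<in>vfields M. \<forall>y\<in>vfields M. \<forall>z\<in>vfields M. D (x + y) z = D x z + D y z) \<and>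
     (\<forall>f\<in>smooth_funs M. \<forall>x\<in>vfields M. \<forall>y\<in>vfields M. D (f \<cdot>\<^sub>v x) y = f \<cdot>\<^sub>v D x y) \<and>
     (\<forall>x\<in>vfields M. \<forall>y\<in>vfields M. \<forall>z\<in>vfields M. D x (y + z) = D x y + D x z) \<and>
     (\<forall>f\<in>smooth_funs M. \<forall>x\<in>vfields M. \<forall>y\<in>vfields M.
        D x (f \<cdot>\<^sub>v y) = deriv_along x f \<cdot>\<^sub>v y + f \<cdot>\<^sub>v D x y) \<and>
     (\<forall>x\<in>vfields M. \<forall>y\<in>vfields M. D x y - D y x = lie_bracket x y) \<and>
     (\<forall>x\<in>vfields M. \<forall>y\<in>vfields M. \<forall>z\<in>vfields M.
        deriv_along x (g y z) = g (D x y) z + g y (D x z))"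

definition ext_deriv1 :: "'a tensor01 \<Rightarrow> 'a tensor02" where
  "ext_deriv1 \<theta> x y = deriv_along x (\<theta> y) - deriv_along y (\<theta> x) - \<theta> (lie_bracket x y)"


section \<open>Almost contact metric manifolds\<close>

text \<open>The component \<open>conn\<close> is required below to be the Levi-Civita connection of \<open>metric\<close>.  By the
  fundamental theorem of Riemannian geometry it exists and is determined on vector fields by the other
  components, so it is a name for \<open>\<nabla>\<close> and not additional structure.\<close>

record ('a, 'e) acm = "('a, 'e) manifold" +
  phi :: "'a tensor11"
  xi :: "'a vfield"
  eta :: "'a tensor01"
  metric :: "'a tensor02"
  conn :: "'a vfield \<Rightarrow> 'a vfield \<Rightarrow> 'a vfield"

definition almost_contact_metric :: "nat \<Rightarrow> ('a, 'e::euclidean_space) acm \<Rightarrow> bool" where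
  "almost_contact_metric n M \<longleftrightarrow>
     smooth_manifold M \<and> DIM('e) = 2 * n + 1 \<and>
     phi M \<in> tensors11 M \<and> xi M \<in> vfields M \<and> eta M \<in> one_forms M \<and>
     riemannian_metric M (metric M) \<and>
     (\<forall>x\<in>vfields M. phi M (phi M x) = - x + eta M x \<cdot>\<^sub>v xi M) \<and>
     phi M (xi M) = 0 \<and>
     (\<forall>x\<in>vfields M. eta M (phi M x) = 0) \<and>
     (\<forall>p\<in>pts M. metric M (xi M) (xi M) p = 1) \<and>
     (\<forall>x\<in>vfields M. \<forall>y\<in>vfields M.
        metric M (phi M x) (phi M y) = metric M x y - eta M x * eta M y) \<and>
     levi_civita M (metric M) (conn M)"

definition nabla01 :: "('a, 'e) acm \<Rightarrow> 'a tensor01 \<Rightarrow> 'a tensor02" where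
  "nabla01 M \<theta> x y = deriv_along x (\<theta> y) - \<theta> (conn M x y)"

definition nabla02 :: "('a, 'e) acm \<Rightarrow> 'a tensor02 \<Rightarrow> 'a vfield \<Rightarrow> 'a tensor02" where
  "nabla02 M B x y z = deriv_along x (B y z) - B (conn M x y) z - B y (conn M x z)"

definition h_proj :: "('a, 'e) acm \<Rightarrow> 'a tensor11" where
  "h_proj M x = - phi M (phi M x)"

definition Phi_form :: "('a, 'e) acm \<Rightarrow> 'a tensor02" where
  "Phi_form M x y = metric M x (phi M y)"

definition F_tensor :: "('a, 'e) acm \<Rightarrow> 'a vfield \<Rightarrow> 'a tensor02" where
  "F_tensor M x y z = - nabla02 M (Phi_form M) x y z"

definition omega_form :: "('a, 'e) acm \<Rightarrow> 'a tensor01" where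
  "omega_form M z = F_tensor M (xi M) (xi M) z"

definition lee_form :: "('a, 'e) acm \<Rightarrow> 'a tensor01" where
  "lee_form M z = omega_form M (phi M z)"


section \<open>Components of a (0,2)-tensor\<close>

definition sym_part :: "'a tensor02 \<Rightarrow> 'a tensor02" where
  "sym_part L x y = (\<lambda>p. (L x y p + L y x p) / 2)"

definition alt_part :: "'a tensor02 \<Rightarrow> 'a tensor02" where
  "alt_part L x y = (\<lambda>p. (L x y p - L y x p) / 2)"

definition h_part :: "('a, 'e) acm \<Rightarrow> 'a tensor02 \<Rightarrow> 'a tensor02" where
  "h_part M L x y = L (h_proj M x) (h_proj M y)"

definition v_part :: "('a, 'e) acm \<Rightarrow> 'a tensor02 \<Rightarrow> 'a tensor02" where
  "v_part M L x y = (\<lambda>p. eta M x p * L (xi M) y p + eta M y p * L x (xi M) p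
     - 2 * eta M x p * eta M y p * L (xi M) (xi M) p)"

definition w_part :: "('a, 'e) acm \<Rightarrow> 'a tensor02 \<Rightarrow> 'a tensor02" where
  "w_part M L x y = (\<lambda>p. eta M x p * eta M y p * L (xi M) (xi M) p)"

definition comp_phi :: "('a, 'e) acm \<Rightarrow> 'a tensor02 \<Rightarrow> 'a tensor02" where
  "comp_phi M L x y = L (phi M x) (phi M y)"

text \<open>A local basis near \<open>p\<close> consists of global vector fields forming a basis of the tangent spaces
  on a neighbourhood of \<open>p\<close>; every local frame agrees near \<open>p\<close> with such fields.\<close>

definition local_basis_at ::
    "('a, 'e::euclidean_space, 'm) manifold_scheme \<Rightarrow> 'a \<Rightarrow> (nat \<Rightarrow> 'a vfield) \<Rightarrow> bool" where
  "local_basis_at M p e \<longleftrightarrow> (\<forall>i<DIM('e). e i \<in> vfields M) \<and>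
     (\<exists>U. openin (mtop M) U \<and> p \<in> U \<and>
       (\<forall>q\<in>U. \<forall>v\<in>tangent_space M q.
          \<exists>!a. (\<forall>i\<ge>DIM('e). a i = 0) \<and> v = (\<lambda>f. \<Sum>i<DIM('e). a i * e i q f)))"

text \<open>The numbers \<open>g(e\<^sup>i, e\<^sup>j)\<close> for the dual basis are the entries \<open>G i j\<close> of the inverse of the
  matrix \<open>g(e\<^sub>i, e\<^sub>j)\<close>.  The trace does not depend on the local basis.\<close>

definition metric_trace :: "('a, 'e::euclidean_space) acm \<Rightarrow> 'a tensor02 \<Rightarrow> 'a \<Rightarrow> real" where
  "metric_trace M B p = (THE t. \<exists>e G. local_basis_at M p e \<and>
     (\<forall>i<DIM('e). \<forall>k<DIM('e).
        (\<Sum>j<DIM('e). G i j * metric M (e j) (e k) p) = (if i = k then 1 else 0)) \<and>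
     t = (\<Sum>i<DIM('e). \<Sum>j<DIM('e). G i j * B (e i) (e j) p))"

definition alpha_tr :: "('a, 'e::euclidean_space) acm \<Rightarrow> 'a tensor02 \<Rightarrow> 'a \<Rightarrow> real" where
  "alpha_tr M L = metric_trace M (h_part M L)"

definition beta_tr :: "('a, 'e::euclidean_space) acm \<Rightarrow> 'a tensor02 \<Rightarrow> 'a \<Rightarrow> real" where
  "beta_tr M L = metric_trace M (\<lambda>x y. h_part M L x (phi M y))"

text \<open>For \<open>n = 0\<close> the quotients below are \<open>0\<close>; then also \<open>h = 0\<close> on vector fields.\<close>

definition L1 :: "nat \<Rightarrow> ('a, 'e::euclidean_space) acm \<Rightarrow> 'a tensor02 \<Rightarrow> 'a tensor02" where
  "L1 n M L x y = (\<lambda>p. alpha_tr M L p / (2 * real n) * h_part M (metric M) x y p)"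

definition L2 :: "nat \<Rightarrow> ('a, 'e::euclidean_space) acm \<Rightarrow> 'a tensor02 \<Rightarrow> 'a tensor02" where
  "L2 n M L x y = (\<lambda>p. (sym_part (h_part M L) x y p + comp_phi M (sym_part (h_part M L)) x y p) / 2
     - L1 n M L x y p)"

definition L3 :: "('a, 'e) acm \<Rightarrow> 'a tensor02 \<Rightarrow> 'a tensor02" where
  "L3 M L x y = (\<lambda>p. (sym_part (h_part M L) x y p - comp_phi M (sym_part (h_part M L)) x y p) / 2)"

definition L4 :: "nat \<Rightarrow> ('a, 'e::euclidean_space) acm \<Rightarrow> 'a tensor02 \<Rightarrow> 'a tensor02" where
  "L4 n M L x y = (\<lambda>p. - (beta_tr M L p / (2 * real n)) * h_part M (metric M) x (phi M y) p)"

definition L5 :: "nat \<Rightarrow> ('a, 'e::euclidean_space) acm \<Rightarrow> 'a tensor02 \<Rightarrow> 'a tensor02" where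
  "L5 n M L x y = (\<lambda>p. (alt_part (h_part M L) x y p + comp_phi M (alt_part (h_part M L)) x y p) / 2
     - L4 n M L x y p)"

definition L6 :: "('a, 'e) acm \<Rightarrow> 'a tensor02 \<Rightarrow> 'a tensor02" where
  "L6 M L x y = (\<lambda>p. (alt_part (h_part M L) x y p - comp_phi M (alt_part (h_part M L)) x y p) / 2)"

definition L7 :: "('a, 'e) acm \<Rightarrow> 'a tensor02 \<Rightarrow> 'a tensor02" where
  "L7 M L = sym_part (v_part M L)"

definition L8 :: "('a, 'e) acm \<Rightarrow> 'a tensor02 \<Rightarrow> 'a tensor02" where
  "L8 M L = alt_part (v_part M L)"

definition L9 :: "('a, 'e) acm \<Rightarrow> 'a tensor02 \<Rightarrow> 'a tensor02" where
  "L9 M L = w_part M L"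

definition L_comp ::
    "nat \<Rightarrow> ('a, 'e::euclidean_space) acm \<Rightarrow> nat \<Rightarrow> 'a tensor02 \<Rightarrow> 'a tensor02" where
  "L_comp n M i L =
     [L1 n M L, L2 n M L, L3 M L, L4 n M L, L5 n M L, L6 M L, L7 M L, L8 M L, L9 M L] ! (i - 1)"


section \<open>The classes of manifolds\<close>

text \<open>The space \<open>\<Oplus>\<^bsub>i\<in>I\<^esub> \<Omega>\<^sub>i\<close>, for \<open>I \<subseteq> {1..9}\<close>; \<open>\<Omega>\<^sub>i\<close> itself is \<^term>\<open>Omega n M {i}\<close>.\<close>

definition Omega :: "nat \<Rightarrow> ('a, 'e::euclidean_space) acm \<Rightarrow> nat set \<Rightarrow> 'a tensor01 set" where
  "Omega n M I = {\<theta> \<in> one_forms M. \<forall>x\<in>vfields M. \<forall>y\<in>vfields M. \<forall>p\<in>pts M.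
     nabla01 M \<theta> x y p = (\<Sum>i\<in>I. L_comp n M i (nabla01 M \<theta>) x y p)}"

definition W1 :: "nat \<Rightarrow> ('a, 'e::euclidean_space) acm set" where
  "W1 n = {M. almost_contact_metric n M \<and>
     (\<forall>x\<in>vfields M. \<forall>y\<in>vfields M. \<forall>z\<in>vfields M.
        F_tensor M x y z = eta M x * (eta M y * omega_form M z - eta M z * omega_form M y))}"

definition W1_0 :: "nat \<Rightarrow> ('a, 'e::euclidean_space) acm set" where
  "W1_0 n = {M \<in> W1 n. \<forall>x\<in>vfields M. \<forall>y\<in>vfields M. ext_deriv1 (lee_form M) x y = 0}"

text \<open>The class \<open>\<Oplus>\<^bsub>j\<in>I\<^esub> W\<^bsub>1j\<^esub>\<close>; in particular \<open>W\<^bsub>1j\<^esub>\<close> is \<^term>\<open>W1_sum n {j}\<close>.\<close>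

definition W1_sum :: "nat \<Rightarrow> nat set \<Rightarrow> ('a, 'e::euclidean_space) acm set" where
  "W1_sum n I = {M \<in> W1 n. lee_form M \<in> Omega n M I}"

end

theory Submission
  imports Defs
begin

text \<open>
  Both equalities are statements about \<open>L = \<nabla>\<theta>\<close> for the Lee form \<open>\<theta>\<close>.  Since
  \<open>x = hx + \<eta>(x)\<xi>\<close>, every (0,2)-tensor satisfies \<open>L = hL + vL + wL\<close> (\<open>tensor_decomp\<close>).  In the sum of
  the components 1, 2, 3, 7, 8, 9 the trace term of the first cancels against that of the second,
  and what remains is \<open>ShL + vL + wL\<close>; leaving out component 8 gives \<open>ShL + SvL + wL\<close>
  (\<open>sum_L_comp\<close>).

  As \<open>\<nabla>\<close> is torsion free, \<open>d\<theta>(x,y) = L(x,y) - L(y,x)\<close>.  So \<open>L = ShL + SvL + wL\<close> says that \<open>L\<close> is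
  symmetric, that is, \<open>d\<theta> = 0\<close>; this holds for every 1-form and gives the second equality
  (\<open>Omega_12379_iff_closed\<close>).  The first one needs \<open>AhL = 0\<close>, that is, \<open>d\<theta>(hx,hy) = 0\<close> on every
  manifold of \<open>W\<^sub>1\<close>.

  The reason for the latter is that the defining equation of \<open>W\<^sub>1\<close>, with \<open>\<xi>\<close> as last and \<open>\<phi>(y)\<close> as
  second argument, reads \<open>\<nabla>\<eta> = -\<eta> \<otimes> \<theta>\<close> (\<open>conn_xi_W1\<close>), hence \<open>d\<eta> = -\<eta> \<and> \<theta>\<close>.  Differentiating once more gives
  \<open>0 = dd\<eta> = \<eta> \<and> d\<theta>\<close>, so \<open>d\<theta>\<close> vanishes on the kernel of \<open>\<eta>\<close> (\<open>ext_deriv1_kernel\<close>), and this kernel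
  is the image of \<open>h\<close>.  Here \<open>dd\<eta> = 0\<close> is the Jacobi identity for vector fields.

  Since vector fields are derivations of the ring of smooth functions, all of this is algebra over
  that ring once smooth functions are known to be closed under sums and products.
\<close>

section \<open>Closure properties of smooth functions\<close>

lemma Ck_on_const: "Ck_on k S (\<lambda>x. c)"
  by (induction k arbitrary: c) (auto simp: frechet_derivative_const)

text \<open>Openness of \<open>S\<close> is what lets the values on \<open>S\<close> determine the derivatives at points of \<open>S\<close>.
  The congruence is used to rewrite derivatives of sums and products, whose formulas hold only on \<open>S\<close>.\<close>

lemma Ck_on_cong:
  assumes "open S" "\<And>x. x \<in> S \<Longrightarrow> f x = h x" "Ck_on k S f"
  shows "Ck_on k S h"
  using assms(2,3)
proof (induction k arbitrary: f h)
  case 0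
  then show ?case using continuous_on_cong[of S S f h] by auto
next
  case (Suc k)
  have D: "(h has_derivative frechet_derivative f (at x)) (at x)" if "x \<in> S" for x
  proof -
    have "(f has_derivative frechet_derivative f (at x)) (at x)"
      using Suc.prems(2) that \<open>open S\<close>
      by (auto simp: differentiable_on_eq_differentiable_at frechet_derivative_works)
    then show ?thesis
      using has_derivative_transform_within_open[OF _ \<open>open S\<close> that] Suc.prems(1) by blast
  qed
  have eq: "frechet_derivative f (at x) = frechet_derivative h (at x)" if "x \<in> S" for x
    using frechet_derivative_at[OF D[OF that]] .
  have "h differentiable_on S"
    using D \<open>open S\<close> by (auto simp: differentiable_on_eq_differentiable_at differentiable_def)
  moreover have "Ck_on k S (\<lambda>x. frechet_derivative h (at x) v)" for v
    by (rule Suc.IH[of "\<lambda>x. frechet_derivative f (at x) v"]) (use eq Suc.prems in auto)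
  ultimately show ?case by simp
qed

lemma Ck_on_pred: "Ck_on (Suc k) S f \<Longrightarrow> Ck_on k S f"
proof (induction k arbitrary: f)
  case 0
  then show ?case by (simp add: differentiable_imp_continuous_on)
next
  case (Suc k)
  have "Ck_on k S (\<lambda>x. frechet_derivative f (at x) v)" for v
    using Suc by simp
  then show ?case using Suc.prems by simp
qed

lemma Ck_on_add:
  assumes "open S"
  shows "Ck_on k S f \<Longrightarrow> Ck_on k S h \<Longrightarrow> Ck_on k S (\<lambda>x. f x + h x)"
proof (induction k arbitrary: f h)
  case 0
  then show ?case by (simp add: continuous_on_add)
next
  case (Suc k)
  have "frechet_derivative (\<lambda>x. f x + h x) (at x)
      = (\<lambda>v. frechet_derivative f (at x) v + frechet_derivative h (at x) v)" if "x \<in> S" for x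
  proof -
    have "f differentiable at x" "h differentiable at x"
      using Suc.prems that assms by (auto simp: differentiable_on_eq_differentiable_at)
    then show ?thesis
      by (intro frechet_derivative_at[symmetric] has_derivative_add)
         (auto simp: frechet_derivative_works)
  qed
  moreover have "Ck_on k S (\<lambda>x. frechet_derivative f (at x) v + frechet_derivative h (at x) v)" for v
    using Suc by simp
  ultimately have "Ck_on k S (\<lambda>x. frechet_derivative (\<lambda>x. f x + h x) (at x) v)" for v
    using Ck_on_cong[OF assms] by (smt (verit))
  then show ?case using Suc.prems by simp
qed

text \<open>The Leibniz rule for the derivative of \<open>f h\<close> contains \<open>f\<close> and \<open>h\<close> undifferentiated, so the
  induction also uses that \<open>C\<^bsup>k+1\<^esup>\<close> functions are \<open>C\<^sup>k\<close>.\<close>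

lemma Ck_on_mult:
  fixes f h :: "'e::euclidean_space \<Rightarrow> real"
  assumes "open S"
  shows "Ck_on k S f \<Longrightarrow> Ck_on k S h \<Longrightarrow> Ck_on k S (\<lambda>x. f x * h x)"
proof (induction k arbitrary: f h)
  case 0
  then show ?case by (simp add: continuous_on_mult)
next
  case (Suc k)
  have "frechet_derivative (\<lambda>x. f x * h x) (at x)
      = (\<lambda>v. f x * frechet_derivative h (at x) v + frechet_derivative f (at x) v * h x)"
    if "x \<in> S" for x
  proof -
    have "f differentiable at x" "h differentiable at x"
      using Suc.prems that assms by (auto simp: differentiable_on_eq_differentiable_at)
    then show ?thesis
      by (intro frechet_derivative_at[symmetric] has_derivative_mult)
         (auto simp: frechet_derivative_works)
  qed
  moreover have "Ck_on k S (\<lambda>x. f x * frechet_derivative h (at x) v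
      + frechet_derivative f (at x) v * h x)" for v
    using Suc Ck_on_pred[of k S f] Ck_on_pred[of k S h] by (intro Ck_on_add[OF assms] Suc.IH) auto
  ultimately have "Ck_on k S (\<lambda>x. frechet_derivative (\<lambda>x. f x * h x) (at x) v)" for v
    using Ck_on_cong[OF assms] by (smt (verit))
  then show ?case using Suc.prems by simp
qed

locale manifold =
  fixes M :: "('a, 'e::euclidean_space, 'm) manifold_scheme"
  assumes smooth_manifold: "smooth_manifold M"
begin

lemma chart_open: "(U, c) \<in> atlas M \<Longrightarrow> open (c ` U)"
  using smooth_manifold by (auto simp: smooth_manifold_def)

lemma smooth_funs_outside: "f \<in> smooth_funs M \<Longrightarrow> p \<notin> pts M \<Longrightarrow> f p = 0"
  by (simp add: smooth_funs_def)

lemma smooth_funs_add: "f \<in> smooth_funs M \<Longrightarrow> h \<in> smooth_funs M \<Longrightarrow> f + h \<in> smooth_funs M"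
  by (auto simp: smooth_funs_def smooth_on_def o_def split_beta intro!: Ck_on_add chart_open)

lemma smooth_funs_mult: "f \<in> smooth_funs M \<Longrightarrow> h \<in> smooth_funs M \<Longrightarrow> f * h \<in> smooth_funs M"
  by (auto simp: smooth_funs_def smooth_on_def o_def split_beta intro!: Ck_on_mult chart_open)

lemma smooth_funs_scale: "f \<in> smooth_funs M \<Longrightarrow> (\<lambda>q. a * f q) \<in> smooth_funs M"
  by (auto simp: smooth_funs_def smooth_on_def o_def split_beta
      intro!: Ck_on_mult Ck_on_const chart_open)

lemma smooth_funs_uminus: "f \<in> smooth_funs M \<Longrightarrow> - f \<in> smooth_funs M"
  using smooth_funs_scale[of f "-1"] by (simp add: fun_Compl_def)

lemma smooth_funs_diff: "f \<in> smooth_funs M \<Longrightarrow> h \<in> smooth_funs M \<Longrightarrow> f - h \<in> smooth_funs M"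
  using smooth_funs_add[of f "- h"] smooth_funs_uminus[of h] by simp

lemma smooth_funs_zero: "0 \<in> smooth_funs M"
  by (auto simp: smooth_funs_def smooth_on_def o_def Ck_on_const)


section \<open>Vector fields, their Lie bracket and one-forms\<close>

lemma vfields_outside: "x \<in> vfields M \<Longrightarrow> p \<notin> pts M \<Longrightarrow> x p = 0"
  by (simp add: vfields_def)

lemma vfields_tangent: "x \<in> vfields M \<Longrightarrow> p \<in> pts M \<Longrightarrow> x p \<in> tangent_space M p"
  by (simp add: vfields_def)

lemma vfields_nonsmooth: "x \<in> vfields M \<Longrightarrow> f \<notin> smooth_funs M \<Longrightarrow> x p f = 0"
  using vfields_tangent[of x p] vfields_outside[of x p]
  by (cases "p \<in> pts M") (auto simp: tangent_space_def)

lemma deriv_along_smooth: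
  "x \<in> vfields M \<Longrightarrow> f \<in> smooth_funs M \<Longrightarrow> deriv_along x f \<in> smooth_funs M"
  by (simp add: vfields_def)

lemma deriv_along_add:
  assumes "x \<in> vfields M" "f \<in> smooth_funs M" "h \<in> smooth_funs M"
  shows "deriv_along x (f + h) = deriv_along x f + deriv_along x h"
proof
  fix p show "deriv_along x (f + h) p = (deriv_along x f + deriv_along x h) p"
    using vfields_tangent[OF assms(1), of p] vfields_outside[OF assms(1), of p] assms(2,3)
    by (cases "p \<in> pts M") (auto simp: tangent_space_def deriv_along_def)
qed

lemma deriv_along_mult:
  assumes "x \<in> vfields M" "f \<in> smooth_funs M" "h \<in> smooth_funs M"
  shows "deriv_along x (f * h) = f * deriv_along x h + h * deriv_along x f"
proof
  fix p show "deriv_along x (f * h) p = (f * deriv_along x h + h * deriv_along x f) p"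
    using vfields_tangent[OF assms(1), of p] vfields_outside[OF assms(1), of p] assms(2,3)
    by (cases "p \<in> pts M") (auto simp: tangent_space_def deriv_along_def)
qed

lemma deriv_along_zero: "x \<in> vfields M \<Longrightarrow> deriv_along x 0 = 0"
  using deriv_along_add[of x 0 0] smooth_funs_zero by simp

lemma deriv_along_diff:
  assumes "x \<in> vfields M" "f \<in> smooth_funs M" "h \<in> smooth_funs M"
  shows "deriv_along x (f - h) = deriv_along x f - deriv_along x h"
  using deriv_along_add[OF assms(1) smooth_funs_diff[OF assms(2,3)] assms(3)] by simp

text \<open>The unit of the ring of smooth functions is the function \<open>u\<close> that is \<open>1\<close> on the manifold and \<open>0\<close>
  outside it.  It is idempotent, so a derivation \<open>v\<close> satisfies \<open>v u = 2 v u\<close>.\<close>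

lemma deriv_along_one:
  assumes "x \<in> vfields M" "u \<in> smooth_funs M" "\<And>p. p \<in> pts M \<Longrightarrow> u p = 1"
  shows "deriv_along x u = 0"
proof
  fix p
  have "u * u = u"
  proof
    fix q show "(u * u) q = u q"
      using assms(3) smooth_funs_outside[OF assms(2)] by (cases "q \<in> pts M") auto
  qed
  then have "deriv_along x u p = 2 * u p * deriv_along x u p"
    using deriv_along_mult[OF assms(1,2,2)] by (metis (no_types, lifting) mult_2 plus_fun_apply
        times_fun_apply distrib_right)
  then show "deriv_along x u p = 0 p"
    using assms(3)[of p] vfields_outside[OF assms(1), of p]
    by (cases "p \<in> pts M") (auto simp: deriv_along_def)
qed

lemma vfields_add:
  assumes "x \<in> vfields M" "y \<in> vfields M"
  shows "x + y \<in> vfields M"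
proof -
  have "deriv_along (x + y) f = deriv_along x f + deriv_along y f" for f
    by (auto simp: deriv_along_def)
  then show ?thesis using assms
    by (auto simp: vfields_def tangent_space_def algebra_simps smooth_funs_add)
qed

lemma vfields_uminus:
  assumes "x \<in> vfields M"
  shows "- x \<in> vfields M"
proof -
  have "deriv_along (- x) f = - deriv_along x f" for f
    by (auto simp: deriv_along_def)
  then show ?thesis using assms
    by (auto simp: vfields_def tangent_space_def algebra_simps smooth_funs_uminus)
qed

lemma vfields_diff: "x \<in> vfields M \<Longrightarrow> y \<in> vfields M \<Longrightarrow> x - y \<in> vfields M"
  using vfields_add[of x "- y"] vfields_uminus[of y] by simp

lemma vfields_vscale:
  assumes "f \<in> smooth_funs M" "x \<in> vfields M"
  shows "f \<cdot>\<^sub>v x \<in> vfields M"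
proof -
  have "deriv_along (f \<cdot>\<^sub>v x) h = f * deriv_along x h" for h
    by (auto simp: deriv_along_def vscale_def)
  then show ?thesis using assms
    by (auto simp: vfields_def tangent_space_def vscale_def algebra_simps smooth_funs_mult)
qed

lemma deriv_along_lie_bracket:
  "deriv_along (lie_bracket x y) f
    = deriv_along x (deriv_along y f) - deriv_along y (deriv_along x f)"
  by (auto simp: deriv_along_def lie_bracket_def)

text \<open>A vector field is \<open>0\<close> on functions that are not smooth, so equality as HOL functions only has
  to be tested on smooth ones.\<close>

lemma vfields_eqI:
  assumes "x \<in> vfields M" "y \<in> vfields M"
    and "\<And>f. f \<in> smooth_funs M \<Longrightarrow> deriv_along x f = deriv_along y f"
  shows "x = y"
proof (intro ext)
  fix p f
  show "x p f = y p f"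
    using assms(3)[of f] vfields_nonsmooth[OF assms(1)] vfields_nonsmooth[OF assms(2)]
    by (cases "f \<in> smooth_funs M") (auto simp: deriv_along_def fun_eq_iff)
qed

text \<open>The closure of vector fields under brackets is a premise here because, in the presence of a
  torsion-free connection, it follows at once from \<open>[x,y] = \<nabla>\<^sub>xy - \<nabla>\<^sub>yx\<close>.\<close>

lemma jacobi:
  assumes closed: "\<And>x y. x \<in> vfields M \<Longrightarrow> y \<in> vfields M \<Longrightarrow> lie_bracket x y \<in> vfields M"
    and x: "x \<in> vfields M" and y: "y \<in> vfields M" and z: "z \<in> vfields M"
  shows "lie_bracket z (lie_bracket x y)
    = lie_bracket x (lie_bracket z y) - lie_bracket y (lie_bracket z x)"
proof (rule vfields_eqI)
  fix f assume f: "f \<in> smooth_funs M"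
  have "deriv_along (v - w) f = deriv_along v f - deriv_along w f" for v w :: "'a vfield"
    by (auto simp: deriv_along_def)
  then show "deriv_along (lie_bracket z (lie_bracket x y)) f
    = deriv_along (lie_bracket x (lie_bracket z y) - lie_bracket y (lie_bracket z x)) f"
    using x y z f
    by (simp add: deriv_along_lie_bracket deriv_along_diff deriv_along_smooth)
qed (use assms in \<open>auto intro!: vfields_diff\<close>)

lemma one_forms_smooth: "\<theta> \<in> one_forms M \<Longrightarrow> x \<in> vfields M \<Longrightarrow> \<theta> x \<in> smooth_funs M"
  by (simp add: one_forms_def)

lemma one_forms_add:
  "\<theta> \<in> one_forms M \<Longrightarrow> x \<in> vfields M \<Longrightarrow> y \<in> vfields M \<Longrightarrow> \<theta> (x + y) = \<theta> x + \<theta> y"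
  by (simp add: one_forms_def)

lemma one_forms_vscale:
  "\<theta> \<in> one_forms M \<Longrightarrow> f \<in> smooth_funs M \<Longrightarrow> x \<in> vfields M \<Longrightarrow> \<theta> (f \<cdot>\<^sub>v x) = f * \<theta> x"
  by (simp add: one_forms_def)

lemma one_forms_diff:
  assumes "\<theta> \<in> one_forms M" "x \<in> vfields M" "y \<in> vfields M"
  shows "\<theta> (x - y) = \<theta> x - \<theta> y"
  using one_forms_add[OF assms(1) vfields_diff[OF assms(2,3)] assms(3)] by simp

lemma one_forms_zero:
  assumes "\<theta> \<in> one_forms M"
  shows "\<theta> 0 = 0"
proof -
  have "0 \<in> vfields M"
    by (auto simp: vfields_def tangent_space_def deriv_along_def smooth_funs_zero[unfolded zero_fun_def])
  then show ?thesis using one_forms_diff[OF assms, of 0 0] by simp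
qed

text \<open>If \<open>d\<eta> = -\<eta> \<and> \<theta>\<close>, then \<open>0 = dd\<eta> = \<eta> \<and> d\<theta>\<close>; inserting \<open>\<xi>\<close> with \<open>\<eta>(\<xi>) = 1\<close> and two fields from
  the kernel of \<open>\<eta>\<close> leaves \<open>d\<theta>(x,y) = 0\<close>.  The proof evaluates \<open>dd\<eta>(\<xi>,x,y)\<close> without introducing
  2-forms: on the kernel, \<open>\<theta>(v) = -d\<eta>(\<xi>,v) = \<eta>([\<xi>,v])\<close>, and the values of \<open>d\<eta>\<close> on \<open>(x, [\<xi>,y])\<close> and
  \<open>(y, [\<xi>,x])\<close> express \<open>x(\<theta>(y))\<close> and \<open>y(\<theta>(x))\<close> through double brackets, which the Jacobi identity
  matches with \<open>\<theta>([x,y])\<close>.\<close>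

lemma ext_deriv1_kernel:
  assumes closed: "\<And>x y. x \<in> vfields M \<Longrightarrow> y \<in> vfields M \<Longrightarrow> lie_bracket x y \<in> vfields M"
    and \<eta>: "\<eta> \<in> one_forms M" and \<theta>: "\<theta> \<in> one_forms M" and \<xi>: "\<xi> \<in> vfields M"
    and \<eta>_\<xi>: "\<And>p. p \<in> pts M \<Longrightarrow> \<eta> \<xi> p = 1"
    and d\<eta>: "\<And>x y. x \<in> vfields M \<Longrightarrow> y \<in> vfields M \<Longrightarrow> ext_deriv1 \<eta> x y = \<eta> y * \<theta> x - \<eta> x * \<theta> y"
    and x: "x \<in> vfields M" "\<eta> x = 0" and y: "y \<in> vfields M" "\<eta> y = 0"
  shows "ext_deriv1 \<theta> x y = 0"
proof -
  have \<theta>_eq: "\<theta> v = \<eta> (lie_bracket \<xi> v)" if "v \<in> vfields M" "\<eta> v = 0" for v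
  proof -
    have "\<eta> \<xi> * \<theta> v = \<theta> v"
    proof
      fix p show "(\<eta> \<xi> * \<theta> v) p = \<theta> v p"
        using \<eta>_\<xi> smooth_funs_outside[OF one_forms_smooth[OF \<theta> that(1)]]
        by (cases "p \<in> pts M") auto
    qed
    moreover have "deriv_along v (\<eta> \<xi>) = 0"
      using deriv_along_one[OF that(1) one_forms_smooth[OF \<eta> \<xi>] \<eta>_\<xi>] by blast
    ultimately show ?thesis
      using d\<eta>[OF \<xi> that(1)] that(2) deriv_along_zero[OF \<xi>]
      by (simp add: ext_deriv1_def)
  qed
  \<comment> \<open>This is the hypothesis on \<open>d\<eta>\<close>, evaluated at \<open>v\<close> and \<open>[\<xi>,w]\<close>.\<close>
  have bracket: "deriv_along v (\<theta> w) - \<eta> (lie_bracket v (lie_bracket \<xi> w)) = \<theta> v * \<theta> w"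
    if "v \<in> vfields M" "\<eta> v = 0" "w \<in> vfields M" "\<eta> w = 0" for v w
    using d\<eta>[OF that(1) closed[OF \<xi> that(3)]] that \<theta>_eq[OF that(3,4)]
      deriv_along_zero[OF closed[OF \<xi> that(3)]]
    by (simp add: ext_deriv1_def mult.commute)
  \<comment> \<open>The kernel of \<open>\<eta>\<close> is involutive, so the formula for \<open>\<theta>\<close> also applies to \<open>[x,y]\<close>.\<close>
  have "\<eta> (lie_bracket x y) = 0"
    using d\<eta>[OF x(1) y(1)] x y deriv_along_zero by (simp add: ext_deriv1_def)
  then have "\<theta> (lie_bracket x y) = \<eta> (lie_bracket \<xi> (lie_bracket x y))"
    using \<theta>_eq closed x y by blast
  also have "\<dots> = \<eta> (lie_bracket x (lie_bracket \<xi> y)) - \<eta> (lie_bracket y (lie_bracket \<xi> x))"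
    using jacobi[OF closed x(1) y(1) \<xi>] one_forms_diff[OF \<eta>] closed x y \<xi> by simp
  finally have "ext_deriv1 \<theta> x y = \<theta> x * \<theta> y - \<theta> y * \<theta> x"
    using bracket[OF x y] bracket[OF y x] by (simp add: ext_deriv1_def algebra_simps)
  then show ?thesis by (simp add: mult.commute)
qed

end


section \<open>The covariant derivative of the Lee form\<close>

locale acm_manifold =
  fixes n :: nat and M :: "('a, 'e::euclidean_space) acm"
  assumes almost_contact_metric: "almost_contact_metric n M"
begin

sublocale manifold M
  using almost_contact_metric by unfold_locales (simp add: almost_contact_metric_def)

abbreviation D where "D \<equiv> conn M"
abbreviation g where "g \<equiv> metric M"
abbreviation \<phi> where "\<phi> \<equiv> phi M"
abbreviation \<xi> where "\<xi> \<equiv> xi M"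
abbreviation \<eta> where "\<eta> \<equiv> eta M"
abbreviation VF where "VF \<equiv> vfields M"

lemma xi_vfield: "\<xi> \<in> VF" and eta_one_form: "\<eta> \<in> one_forms M"
  and phi_vfield: "x \<in> VF \<Longrightarrow> \<phi> x \<in> VF"
  and phi_add: "x \<in> VF \<Longrightarrow> y \<in> VF \<Longrightarrow> \<phi> (x + y) = \<phi> x + \<phi> y"
  and phi_vscale: "f \<in> smooth_funs M \<Longrightarrow> x \<in> VF \<Longrightarrow> \<phi> (f \<cdot>\<^sub>v x) = f \<cdot>\<^sub>v \<phi> x"
  and phi_phi: "x \<in> VF \<Longrightarrow> \<phi> (\<phi> x) = - x + \<eta> x \<cdot>\<^sub>v \<xi>"
  and phi_xi: "\<phi> \<xi> = 0"
  and eta_phi: "x \<in> VF \<Longrightarrow> \<eta> (\<phi> x) = 0"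
  and metric_xi_xi: "p \<in> pts M \<Longrightarrow> g \<xi> \<xi> p = 1"
  and metric_phi_phi: "x \<in> VF \<Longrightarrow> y \<in> VF \<Longrightarrow> g (\<phi> x) (\<phi> y) = g x y - \<eta> x * \<eta> y"
  using almost_contact_metric by (auto simp: almost_contact_metric_def tensors11_def)

lemma metric_sym: "x \<in> VF \<Longrightarrow> y \<in> VF \<Longrightarrow> g x y = g y x"
  and metric_one_form: "x \<in> VF \<Longrightarrow> g x \<in> one_forms M"
  using almost_contact_metric
  by (auto simp: almost_contact_metric_def riemannian_metric_def tensors02_def)

lemma conn_vfield: "x \<in> VF \<Longrightarrow> y \<in> VF \<Longrightarrow> D x y \<in> VF"
  and conn_add_left: "x \<in> VF \<Longrightarrow> y \<in> VF \<Longrightarrow> z \<in> VF \<Longrightarrow> D (x + y) z = D x z + D y z"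
  and conn_vscale_left:
    "f \<in> smooth_funs M \<Longrightarrow> x \<in> VF \<Longrightarrow> y \<in> VF \<Longrightarrow> D (f \<cdot>\<^sub>v x) y = f \<cdot>\<^sub>v D x y"
  and conn_add_right: "x \<in> VF \<Longrightarrow> y \<in> VF \<Longrightarrow> z \<in> VF \<Longrightarrow> D x (y + z) = D x y + D x z"
  and conn_vscale_right: "f \<in> smooth_funs M \<Longrightarrow> x \<in> VF \<Longrightarrow> y \<in> VF \<Longrightarrow>
    D x (f \<cdot>\<^sub>v y) = deriv_along x f \<cdot>\<^sub>v y + f \<cdot>\<^sub>v D x y"
  and conn_torsion_free: "x \<in> VF \<Longrightarrow> y \<in> VF \<Longrightarrow> D x y - D y x = lie_bracket x y"
  and conn_metric: "x \<in> VF \<Longrightarrow> y \<in> VF \<Longrightarrow> z \<in> VF \<Longrightarrow>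
    deriv_along x (g y z) = g (D x y) z + g y (D x z)"
  using almost_contact_metric by (auto simp: almost_contact_metric_def levi_civita_def)

lemma lie_bracket_vfield: "x \<in> VF \<Longrightarrow> y \<in> VF \<Longrightarrow> lie_bracket x y \<in> VF"
  using conn_torsion_free[of x y] vfields_diff[of "D x y" "D y x"] conn_vfield by simp

lemma h_proj_vfield: "x \<in> VF \<Longrightarrow> h_proj M x \<in> VF"
  by (simp add: h_proj_def phi_vfield vfields_uminus)

lemma h_proj_decomp:
  assumes "x \<in> VF"
  shows "x = h_proj M x + \<eta> x \<cdot>\<^sub>v \<xi>"
  by (simp add: h_proj_def phi_phi[OF assms])

text \<open>From \<open>0 = \<phi>(\<phi>(\<xi>)) = -\<xi> + \<eta>(\<xi>)\<xi>\<close>: pairing with \<open>\<xi>\<close>, which has length 1, gives \<open>\<eta>(\<xi>) = 1\<close>.\<close>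

lemma eta_xi: "p \<in> pts M \<Longrightarrow> \<eta> \<xi> p = 1"
proof -
  assume p: "p \<in> pts M"
  have s: "\<eta> \<xi> \<in> smooth_funs M"
    using one_forms_smooth[OF eta_one_form xi_vfield] .
  have "\<phi> 0 = 0"
    using phi_add[OF vfields_diff[OF xi_vfield xi_vfield] vfields_diff[OF xi_vfield xi_vfield]] by simp
  then have "\<xi> = \<eta> \<xi> \<cdot>\<^sub>v \<xi>"
    using phi_phi[OF xi_vfield] phi_xi by (simp add: add_eq_0_iff2)
  then have "g \<xi> \<xi> = \<eta> \<xi> * g \<xi> \<xi>"
    using one_forms_vscale[OF metric_one_form[OF xi_vfield] s xi_vfield] by simp
  then show ?thesis
    using metric_xi_xi[OF p] by (metis mult.right_neutral times_fun_apply)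
qed

lemma times_eta_xi: "f \<in> smooth_funs M \<Longrightarrow> f * \<eta> \<xi> = f"
proof
  fix p assume "f \<in> smooth_funs M"
  then show "(f * \<eta> \<xi>) p = f p"
    using eta_xi smooth_funs_outside[of f p] by (cases "p \<in> pts M") auto
qed

lemma eta_h_proj: "x \<in> VF \<Longrightarrow> \<eta> (h_proj M x) = 0"
  using one_forms_diff[OF eta_one_form, of 0 "\<phi> (\<phi> x)"] vfields_diff[of x x]
  by (simp add: h_proj_def phi_vfield eta_phi one_forms_zero[OF eta_one_form])

lemma eta_eq_metric:
  assumes "x \<in> VF"
  shows "\<eta> x = g x \<xi>"
  using metric_phi_phi[OF assms xi_vfield] phi_xi
    one_forms_zero[OF metric_one_form[OF phi_vfield[OF assms]]]
    times_eta_xi[OF one_forms_smooth[OF eta_one_form assms]] by simp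

text \<open>Because \<open>\<Phi>(\<xi>, -) = \<eta> \<circ> \<phi> = 0\<close>, only the term with \<open>\<nabla>\<^sub>\<xi>\<xi>\<close> of \<open>(\<nabla>\<^sub>\<xi>\<Phi>)(\<xi>, -)\<close> survives.  This
  presents the Lee form as \<open>g(\<nabla>\<^sub>\<xi>\<xi>, \<phi>\<phi>-)\<close>, from which it is visibly tensorial.\<close>

lemma Phi_xi: "x \<in> VF \<Longrightarrow> Phi_form M \<xi> x = 0"
  using eta_eq_metric[OF phi_vfield] eta_phi metric_sym[OF xi_vfield phi_vfield]
  by (simp add: Phi_form_def)

lemma omega_eq:
  assumes "z \<in> VF"
  shows "omega_form M z = g (D \<xi> \<xi>) (\<phi> z)"
  using Phi_xi[OF assms] Phi_xi[OF conn_vfield[OF xi_vfield assms]] deriv_along_zero[OF xi_vfield]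
  by (simp add: omega_form_def F_tensor_def nabla02_def) (simp add: Phi_form_def)

lemma lee_eq: "z \<in> VF \<Longrightarrow> lee_form M z = g (D \<xi> \<xi>) (\<phi> (\<phi> z))"
  by (simp add: lee_form_def omega_eq phi_vfield)

lemma lee_one_form: "lee_form M \<in> one_forms M"
  using metric_one_form[OF conn_vfield[OF xi_vfield xi_vfield]] phi_vfield
  by (auto simp: one_forms_def lee_eq vfields_add vfields_vscale phi_add phi_vscale)

text \<open>\<open>\<xi>\<close> has constant length, so \<open>0 = x(g(\<xi>,\<xi>)) = 2 g(\<nabla>\<^sub>x\<xi>, \<xi>)\<close>.\<close>

lemma eta_conn_xi:
  assumes "x \<in> VF"
  shows "\<eta> (D x \<xi>) = 0"
proof -
  have "deriv_along x (g \<xi> \<xi>) = 0"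
    using deriv_along_one[OF assms one_forms_smooth[OF metric_one_form[OF xi_vfield] xi_vfield]]
      metric_xi_xi by blast
  then have "g (D x \<xi>) \<xi> + g (D x \<xi>) \<xi> = 0"
    using conn_metric[OF assms xi_vfield xi_vfield]
      metric_sym[OF xi_vfield conn_vfield[OF assms xi_vfield]] by simp
  then have "g (D x \<xi>) \<xi> = 0" by (auto simp: fun_eq_iff)
  then show ?thesis
    using eta_eq_metric[OF conn_vfield[OF assms xi_vfield]] by simp
qed

text \<open>The left side is \<open>(\<nabla>\<^sub>x\<eta>)(y)\<close>.  As \<open>\<phi>(\<xi>) = 0\<close>, one has \<open>F(x,z,\<xi>) = g(z, \<phi>(\<nabla>\<^sub>x\<xi>))\<close>, and the equation
  of \<open>W\<^sub>1\<close> turns this into \<open>-\<eta>(x)\<omega>(z)\<close>.  Taking \<open>z = \<phi>(y)\<close> turns \<open>\<omega>\<close> into \<open>\<theta>\<close> and removes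
  \<open>\<phi>\<close> from the metric, up to the term \<open>\<eta>(y)\<eta>(\<nabla>\<^sub>x\<xi>)\<close>, which vanishes.\<close>

lemma conn_xi_W1:
  assumes W1: "M \<in> W1 n" and x: "x \<in> VF" and y: "y \<in> VF"
  shows "g y (D x \<xi>) = - \<eta> x * lee_form M y"
proof -
  have F: "F_tensor M x z \<xi> = g z (\<phi> (D x \<xi>))" if z: "z \<in> VF" for z
    using deriv_along_zero[OF x] one_forms_zero[OF metric_one_form] z x conn_vfield
    by (simp add: F_tensor_def nabla02_def Phi_form_def phi_xi)
  have "omega_form M \<xi> = 0"
    using one_forms_zero[OF metric_one_form[OF conn_vfield[OF xi_vfield xi_vfield]]]
    by (simp add: omega_eq xi_vfield phi_xi)
  then have "F_tensor M x z \<xi> = \<eta> x * (- (\<eta> \<xi> * omega_form M z))" if "z \<in> VF" for z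
    using W1 x that xi_vfield by (simp add: W1_def)
  then have "g (\<phi> y) (\<phi> (D x \<xi>)) = \<eta> x * (- (lee_form M y * \<eta> \<xi>))"
    using F phi_vfield[OF y] by (simp add: lee_form_def mult.commute)
  also have "\<dots> = - \<eta> x * lee_form M y"
    using times_eta_xi[OF one_forms_smooth[OF lee_one_form y]] by simp
  finally show ?thesis
    using metric_phi_phi[OF y conn_vfield[OF x xi_vfield]] eta_conn_xi[OF x] by simp
qed

text \<open>The antisymmetrization of \<open>\<nabla>\<eta> = -\<eta> \<otimes> \<theta>\<close>.\<close>

lemma ext_deriv_eta_W1:
  assumes W1: "M \<in> W1 n" and x: "x \<in> VF" and y: "y \<in> VF"
  shows "ext_deriv1 \<eta> x y = \<eta> y * lee_form M x - \<eta> x * lee_form M y"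
proof -
  have nabla_eta: "deriv_along v (\<eta> w) = \<eta> (D v w) - \<eta> v * lee_form M w"
    if "v \<in> VF" "w \<in> VF" for v w
    using conn_metric[OF that xi_vfield] conn_xi_W1[OF W1 that] that
    by (simp add: eta_eq_metric[OF that(2)] eta_eq_metric[OF conn_vfield[OF that]])
  have "\<eta> (lie_bracket x y) = \<eta> (D x y) - \<eta> (D y x)"
    using one_forms_diff[OF eta_one_form] conn_vfield x y conn_torsion_free[OF x y] by metis
  then show ?thesis
    using nabla_eta x y by (simp add: ext_deriv1_def)
qed

lemma ext_deriv_lee_horizontal:
  assumes "M \<in> W1 n" "x \<in> VF" "y \<in> VF"
  shows "ext_deriv1 (lee_form M) (h_proj M x) (h_proj M y) = 0"
  using ext_deriv1_kernel[OF lie_bracket_vfield eta_one_form lee_one_form xi_vfield eta_xi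
      ext_deriv_eta_W1] assms
  by (simp add: h_proj_vfield eta_h_proj)

lemma ext_deriv1_eq_nabla:
  assumes "\<theta> \<in> one_forms M" "x \<in> VF" "y \<in> VF"
  shows "ext_deriv1 \<theta> x y = nabla01 M \<theta> x y - nabla01 M \<theta> y x"
proof -
  have "\<theta> (lie_bracket x y) = \<theta> (D x y) - \<theta> (D y x)"
    using one_forms_diff[OF assms(1)] conn_vfield assms(2,3) conn_torsion_free[OF assms(2,3)] by metis
  then show ?thesis by (simp add: ext_deriv1_def nabla01_def)
qed

text \<open>In the second argument the non-tensorial terms \<open>x(f) \<theta>(y)\<close> of \<open>x(\<theta>(f y))\<close> and of
  \<open>\<theta>(\<nabla>\<^sub>x(f y))\<close> cancel.\<close>

lemma nabla01_tensor:
  assumes \<theta>: "\<theta> \<in> one_forms M"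
  shows "nabla01 M \<theta> \<in> tensors02 M"
proof -
  note s = one_forms_smooth[OF \<theta>] deriv_along_smooth conn_vfield vfields_vscale vfields_add
  have "deriv_along (x + y) f = deriv_along x f + deriv_along y f" for x y :: "'a vfield" and f
    by (auto simp: deriv_along_def)
  moreover have "deriv_along (f \<cdot>\<^sub>v x) h = f * deriv_along x h" for x :: "'a vfield" and f h
    by (auto simp: deriv_along_def vscale_def)
  ultimately show ?thesis
    by (simp add: tensors02_def one_forms_def nabla01_def s smooth_funs_diff deriv_along_add
        deriv_along_mult conn_add_left conn_add_right conn_vscale_left conn_vscale_right
        one_forms_add[OF \<theta>] one_forms_vscale[OF \<theta>] algebra_simps)
qed


section \<open>Decomposition of a (0,2)-tensor\<close>

text \<open>Expanding \<open>B(hx + \<eta>(x)\<xi>, hy + \<eta>(y)\<xi>)\<close> gives the term \<open>\<eta>(x)\<eta>(y)B(\<xi>,\<xi>)\<close> once, while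
  \<open>\<eta>(x)B(\<xi>,y) + \<eta>(y)B(x,\<xi>)\<close> contains it twice; the last term of \<open>vB\<close> and the part \<open>wB\<close> account
  for this.\<close>

lemma tensor_decomp:
  assumes B: "B \<in> tensors02 M" and x: "x \<in> VF" and y: "y \<in> VF"
  shows "B x y p = h_part M B x y p + v_part M B x y p + w_part M B x y p"
proof -
  have left: "B (h_proj M v + \<eta> v \<cdot>\<^sub>v \<xi>) z = B (h_proj M v) z + \<eta> v * B \<xi> z"
    if "v \<in> VF" "z \<in> VF" for v z
    using B that h_proj_vfield xi_vfield vfields_vscale one_forms_smooth[OF eta_one_form]
    by (simp add: tensors02_def one_forms_def)
  have right: "B z (h_proj M v + \<eta> v \<cdot>\<^sub>v \<xi>) = B z (h_proj M v) + \<eta> v * B z \<xi>"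
    if "v \<in> VF" "z \<in> VF" for v z
    using B that h_proj_vfield xi_vfield vfields_vscale one_forms_smooth[OF eta_one_form]
    by (simp add: tensors02_def one_forms_def)
  have "B x y = B (h_proj M x) y + \<eta> x * B \<xi> y"
    using left[OF x y] h_proj_decomp[OF x] by simp
  moreover have "B x \<xi> = B (h_proj M x) \<xi> + \<eta> x * B \<xi> \<xi>"
    using left[OF x xi_vfield] h_proj_decomp[OF x] by simp
  moreover have "B z y = B z (h_proj M y) + \<eta> y * B z \<xi>" if "z \<in> VF" for z
    using right[OF y that] h_proj_decomp[OF y] by simp
  ultimately show ?thesis
    using x xi_vfield h_proj_vfield
    by (simp add: h_part_def v_part_def w_part_def algebra_simps)
qed

text \<open>The trace \<open>\<alpha>\<close> enters components 1 and 2 with opposite signs, and the parts composed with \<open>\<phi>\<close> enter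
  components 2 and 3 with opposite signs; both cancel.\<close>

lemma sum_L_comp:
  "(\<Sum>i\<in>{1, 2, 3, 7, 8, 9}. L_comp n M i L x y p)
    = sym_part (h_part M L) x y p + v_part M L x y p + w_part M L x y p"
  "(\<Sum>i\<in>{1, 2, 3, 7, 9}. L_comp n M i L x y p)
    = sym_part (h_part M L) x y p + sym_part (v_part M L) x y p + w_part M L x y p"
  by (simp_all add: L_comp_def L2_def L3_def L7_def L8_def L9_def numeral_eq_Suc)
     (simp_all add: sym_part_def alt_part_def field_simps)

text \<open>By the decomposition, membership amounts to \<open>hL = ShL\<close>, which is the vanishing of \<open>d\<theta>\<close> on
  horizontal fields.\<close>

lemma lee_Omega_123789:
  assumes W1: "M \<in> W1 n"
  shows "lee_form M \<in> Omega n M {1, 2, 3, 7, 8, 9}"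
proof -
  let ?L = "nabla01 M (lee_form M)"
  have "?L x y p = sym_part (h_part M ?L) x y p + v_part M ?L x y p + w_part M ?L x y p"
    if x: "x \<in> VF" and y: "y \<in> VF" for x y p
  proof -
    have "?L (h_proj M x) (h_proj M y) = ?L (h_proj M y) (h_proj M x)"
      using ext_deriv_lee_horizontal[OF W1 x y]
        ext_deriv1_eq_nabla[OF lee_one_form h_proj_vfield[OF x] h_proj_vfield[OF y]] by simp
    then show ?thesis
      using tensor_decomp[OF nabla01_tensor[OF lee_one_form] x y]
      by (simp add: sym_part_def h_part_def)
  qed
  then show ?thesis
    using lee_one_form by (simp only: Omega_def sum_L_comp) blast
qed

text \<open>All three summands \<open>ShL\<close>, \<open>SvL\<close>, \<open>wL\<close> are symmetric, so their sum can equal \<open>L\<close> only if \<open>L\<close> is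
  symmetric; for symmetric \<open>L\<close> they are \<open>hL\<close>, \<open>vL\<close>, \<open>wL\<close>.  Symmetry of \<open>\<nabla>\<theta>\<close> is closedness of \<open>\<theta>\<close>.\<close>

lemma Omega_12379_iff_closed:
  assumes \<theta>: "\<theta> \<in> one_forms M"
  shows "\<theta> \<in> Omega n M {1, 2, 3, 7, 9}
    \<longleftrightarrow> (\<forall>x\<in>VF. \<forall>y\<in>VF. ext_deriv1 \<theta> x y = 0)" (is "?O \<longleftrightarrow> ?closed")
proof
  let ?L = "nabla01 M \<theta>"
  assume ?O
  then have L: "?L x y p = sym_part (h_part M ?L) x y p + sym_part (v_part M ?L) x y p
      + w_part M ?L x y p" if "x \<in> VF" "y \<in> VF" "p \<in> pts M" for x y p
    using that by (simp only: Omega_def sum_L_comp) blast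
  show ?closed
  proof (intro ballI ext)
    fix x y p assume x: "x \<in> VF" and y: "y \<in> VF"
    show "ext_deriv1 \<theta> x y p = 0 p"
    proof (cases "p \<in> pts M")
      case True
      then have "?L x y p = ?L y x p"
        using L[OF x y True] L[OF y x True] by (simp add: sym_part_def w_part_def algebra_simps)
      then show ?thesis using ext_deriv1_eq_nabla[OF \<theta> x y] by simp
    next
      case False
      \<comment> \<open>Membership in the sum speaks of points of the manifold only; elsewhere both sides are \<open>0\<close>.\<close>
      have "ext_deriv1 \<theta> x y \<in> smooth_funs M"
        using nabla01_tensor[OF \<theta>] x y ext_deriv1_eq_nabla[OF \<theta> x y]
        by (simp add: tensors02_def one_forms_def smooth_funs_diff)
      then show ?thesis using False smooth_funs_outside by simp
    qed
  qed
next
  let ?L = "nabla01 M \<theta>"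
  assume closed: ?closed
  have sym: "?L x y = ?L y x" if "x \<in> VF" "y \<in> VF" for x y
    using closed that ext_deriv1_eq_nabla[OF \<theta> that] by simp
  have "?L x y p = sym_part (h_part M ?L) x y p + sym_part (v_part M ?L) x y p
      + w_part M ?L x y p" if x: "x \<in> VF" and y: "y \<in> VF" for x y p
    using tensor_decomp[OF nabla01_tensor[OF \<theta>] x y, of p]
      sym[OF h_proj_vfield[OF x] h_proj_vfield[OF y]] sym[OF x xi_vfield] sym[OF y xi_vfield]
    by (simp add: sym_part_def h_part_def v_part_def field_simps)
  then show ?O
    using \<theta> by (simp only: Omega_def sum_L_comp) blast
qed

end

theorem theorem2:
  fixes n :: nat
  shows "(W1 n :: ('a, 'e::euclidean_space) acm set) = W1_sum n {1, 2, 3, 7, 8, 9} \<and>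
         (W1_0 n :: ('a, 'e) acm set) = W1_sum n {1, 2, 3, 7, 9}"
proof -
  have acm: "acm_manifold n M" if "M \<in> W1 n" for M :: "('a, 'e) acm"
    using that by unfold_locales (simp add: W1_def)
  have "lee_form M \<in> Omega n M {1, 2, 3, 7, 8, 9}" if "M \<in> W1 n" for M :: "('a, 'e) acm"
    using acm_manifold.lee_Omega_123789[OF acm[OF that] that] .
  moreover have "lee_form M \<in> Omega n M {1, 2, 3, 7, 9} \<longleftrightarrow>
      (\<forall>x\<in>vfields M. \<forall>y\<in>vfields M. ext_deriv1 (lee_form M) x y = 0)"
    if "M \<in> W1 n" for M :: "('a, 'e) acm"
    using acm_manifold.Omega_12379_iff_closed[OF acm[OF that] acm_manifold.lee_one_form[OF acm[OF that]]] .
  ultimately show ?thesis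
    unfolding W1_sum_def W1_0_def by blast
qed

end
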